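(* Let $\mathbf b=\{b_n\}_{n=1}^{\infty}$ be a nonnegative real sequence. Suppose there exist a natural number $N_0$ and a constant $M(\mathbf b)>0$ such that $$\sum_{n=m}^{2m}|b_n-b_{n+1}|\le M(\mathbf b)\max_{m\le n<m+N_0}b_n\qquad\text{for all } m=1,2,\dots.$$ Then each of the following two properties holds if and only if $\lim_{n\to\infty}nb_n=0$: (i) the series $\sum_{n=1}^{\infty}b_n\sin nx$ converges uniformly on $\mathbb R$; (ii) the series $\sum_{n=1}^\infty b_n\sin nx$ converges everywhere and its sum function $f(x)$ is continuous. *)

theory Defs
  imports "HOL-Analysis.Analysis"
begin

end

theory Submission
  imports Defs
begin

text \<open>If \<open>n b\<^sub>n \<rightarrow> 0\<close>, the hypothesis applied along \<open>m, 2m, 4m, \<dots>\<close> bounds the total variation of \<open>b\<close>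
  beyond \<open>m\<close> by \<open>o(1/m)\<close>. A block of the series is then split at \<open>n \<approx> 1/\<bar>sin (x/2)\<bar>\<close>: below, use
  \<open>\<bar>sin nx\<bar> \<le> 2n \<bar>sin (x/2)\<bar>\<close>, above, use Abel summation.

  Conversely, let the series converge everywhere to a continuous \<open>f\<close>. By Cantor--Lebesgue
  \<open>b\<^sub>n \<rightarrow> 0\<close>, so \<open>F x = - \<Sum> b\<^sub>n sin (nx) / n\<^sup>2\<close> is continuous, and by Riemann its symmetric second
  derivative is \<open>f\<close>. A maximum principle bounds the second differences of \<open>F\<close> near \<open>0\<close> by values of
  \<open>f\<close>, and averaging them yields a series with nonnegative terms, whence
  \<open>\<Sum>\<^sub>n\<^sub>\<le>\<^sub>k n b\<^sub>n = o(k)\<close>. By hypothesis \<open>b\<^sub>k\<close> is bounded by a multiple of the maximum of \<open>b\<close> over every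
  window of length \<open>N0\<close> starting between \<open>k/2\<close> and \<open>k\<close>, so \<open>k b\<^sub>k \<rightarrow> 0\<close>.\<close>

section \<open>Abel summation and elementary sine estimates\<close>

text \<open>Used twice with opposite roles: in \<open>sine_block_le\<close> the coefficients
  \<open>b\<close> are the factor \<open>c\<close> of small variation, in
  \<open>riemann_summation_regular\<close> the terms of the given series are \<open>a\<close> and
  have small block sums.\<close>

lemma abel_summation_bound:
  fixes a c :: "nat \<Rightarrow> real"
  assumes mN: "m \<le> N"
    and A: "\<And>k. m \<le> k \<Longrightarrow> k \<le> N \<Longrightarrow> \<bar>\<Sum>n=m..k. a n\<bar> \<le> A"
  shows "\<bar>\<Sum>n=m..N. a n * c n\<bar> \<le> A * (\<bar>c N\<bar> + (\<Sum>n=m..<N. \<bar>c n - c (Suc n)\<bar>))"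
proof -
  define S where "S k = (\<Sum>n=m..k. a n)" for k
  have "(\<Sum>n=m..N. a n * c n) = S N * c N + (\<Sum>n=m..<N. S n * (c n - c (Suc n)))"
    using mN
  proof (induction N rule: dec_induct)
    case base
    show ?case by (simp add: S_def)
  next
    case (step N)
    then have "S (Suc N) = S N + a (Suc N)"
      by (simp add: S_def)
    with step show ?case
      by (simp add: algebra_simps)
  qed
  also have "\<bar>\<dots>\<bar> \<le> \<bar>S N * c N\<bar> + (\<Sum>n=m..<N. \<bar>S n * (c n - c (Suc n))\<bar>)"
    by (rule order_trans[OF abs_triangle_ineq]) (intro add_left_mono sum_abs)
  also have "\<dots> \<le> A * \<bar>c N\<bar> + (\<Sum>n=m..<N. A * \<bar>c n - c (Suc n)\<bar>)"
    using A mN unfolding abs_mult S_def by (intro add_mono sum_mono mult_right_mono) auto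
  finally show ?thesis
    by (simp add: sum_distrib_left algebra_simps)
qed

lemma uniformly_convergent_on_sumI:
  fixes g :: "nat \<Rightarrow> 'a \<Rightarrow> real"
  assumes "\<And>e. e > 0 \<Longrightarrow> \<exists>m0. \<forall>m\<ge>m0. \<forall>N\<ge>m. \<forall>x\<in>S. \<bar>\<Sum>n=m..N. g n x\<bar> < e"
  shows "uniformly_convergent_on S (\<lambda>N x. \<Sum>n=1..N. g n x)"
proof (rule Cauchy_uniformly_convergent, rule uniformly_Cauchy_onI')
  fix e :: real assume "e > 0"
  then obtain m0 where m0: "\<And>m N x. m \<ge> m0 \<Longrightarrow> N \<ge> m \<Longrightarrow> x \<in> S \<Longrightarrow> \<bar>\<Sum>n=m..N. g n x\<bar> < e"
    using assms by blast
  have "dist (\<Sum>n=1..m. g n x) (\<Sum>n=1..N. g n x) < e"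
    if "x \<in> S" "m \<ge> m0" "N > m" for x m N
  proof -
    have "{1..N} = {1..m} \<union> {Suc m..N}"
      using that by auto
    then have "(\<Sum>n=1..N. g n x) = (\<Sum>n=1..m. g n x) + (\<Sum>n=Suc m..N. g n x)"
      by (simp add: sum.union_disjoint)
    with m0[of "Suc m" N x] that show ?thesis
      by (simp add: dist_real_def)
  qed
  then show "\<exists>M. \<forall>x\<in>S. \<forall>m\<ge>M. \<forall>n>m. dist (\<Sum>n=1..m. g n x) (\<Sum>k=1..n. g k x) < e"
    by blast
qed

lemma abs_sin_of_nat_mult_le:
  fixes y :: real
  shows "\<bar>sin (real n * y)\<bar> \<le> real n * \<bar>sin y\<bar>"
proof (induction n)
  case (Suc n)
  have "\<bar>sin (real (Suc n) * y)\<bar> \<le> \<bar>sin (real n * y)\<bar> * \<bar>cos y\<bar> + \<bar>cos (real n * y)\<bar> * \<bar>sin y\<bar>"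
    using abs_triangle_ineq[of "sin (real n * y) * cos y" "cos (real n * y) * sin y"]
    by (simp add: distrib_right sin_add abs_mult algebra_simps)
  also have "\<dots> \<le> \<bar>sin (real n * y)\<bar> * 1 + 1 * \<bar>sin y\<bar>"
    by (intro add_mono mult_left_mono mult_right_mono) auto
  finally show ?case
    using Suc by (simp add: algebra_simps)
qed simp

text \<open>Multiplying by \<open>2 * sin (x / 2)\<close> makes the sum telescope into a difference
  of two cosines. The product form also covers \<open>sin (x / 2) = 0\<close>.\<close>

lemma abs_sum_sin_le:
  fixes x :: real
  assumes "m \<le> N"
  shows "\<bar>\<Sum>n=m..N. sin (real n * x)\<bar> * \<bar>sin (x / 2)\<bar> \<le> 1"
proof -
  have "2 * sin (x / 2) * (\<Sum>n=m..N. sin (real n * x))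
      = cos ((real m - 1/2) * x) - cos ((real N + 1/2) * x)"
    using assms
  proof (induction N rule: dec_induct)
    case base
    show ?case
      by (simp add: cos_diff_cos algebra_simps)
  next
    case (step N)
    have "2 * sin (x / 2) * sin (real (Suc N) * x)
        = cos ((real N + 1/2) * x) - cos ((real (Suc N) + 1/2) * x)"
    proof -
      have "((real N + 1/2) * x + (real (Suc N) + 1/2) * x) / 2 = real (Suc N) * x"
        "((real (Suc N) + 1/2) * x - (real N + 1/2) * x) / 2 = x / 2"
        by (auto simp: field_simps)
      then show ?thesis
        by (simp only: cos_diff_cos) simp
    qed
    with step show ?case
      by (simp add: algebra_simps)
  qed
  moreover have "\<bar>cos ((real m - 1/2) * x) - cos ((real N + 1/2) * x)\<bar> \<le> 2"
    using abs_triangle_ineq4[of "cos ((real m - 1/2) * x)" "cos ((real N + 1/2) * x)"]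
      abs_cos_le_one[of "(real m - 1/2) * x"] abs_cos_le_one[of "(real N + 1/2) * x"] by linarith
  ultimately have "\<bar>2 * sin (x / 2) * (\<Sum>n=m..N. sin (real n * x))\<bar> \<le> 2"
    by simp
  then show ?thesis
    by (simp add: abs_mult mult.commute)
qed

section \<open>Sufficiency: uniform convergence from the decay of the coefficients\<close>

locale dyadic_bounded_variation =
  fixes b :: "nat \<Rightarrow> real" and N0 :: nat and M :: real
  assumes nonneg: "n \<ge> 1 \<Longrightarrow> b n \<ge> 0"
    and N0_pos: "N0 \<ge> 1"
    and M_pos: "M > 0"
    and variation: "m \<ge> 1 \<Longrightarrow> (\<Sum>n=m..2*m. \<bar>b n - b (n+1)\<bar>) \<le> M * Max (b ` {m..<m+N0})"
begin

text \<open>The block from \<open>m\<close> to \<open>2*m\<close> contributes at most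
  \<open>M * e / m\<close>, and the bound for the rest, starting at \<open>2*m\<close>, is half the
  bound claimed. The factor 2 is thus the sum of a geometric series.\<close>

lemma tail_variation_le:
  assumes "e \<ge> 0" and small: "\<And>n. n \<ge> m0 \<Longrightarrow> real n * b n \<le> e" and "m \<ge> m0" "m \<ge> 1"
  shows "(\<Sum>n=m..<N. \<bar>b n - b (Suc n)\<bar>) \<le> 2 * M * e / real m"
  using \<open>m \<ge> m0\<close> \<open>m \<ge> 1\<close>
proof (induction "N - m" arbitrary: m rule: less_induct)
  case less
  show ?case
  proof (cases "N \<le> m")
    case True
    with \<open>e \<ge> 0\<close> M_pos less.prems show ?thesis by simp
  next
    case False
    have "b n \<le> e / real m" if "n \<in> {m..<m+N0}" for n
    proof -
      have "real m * b n \<le> real n * b n"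
        using that nonneg[of n] less.prems by (intro mult_right_mono) auto
      also have "\<dots> \<le> e"
        using small[of n] that less.prems by auto
      finally show ?thesis
        using less.prems by (simp add: field_simps)
    qed
    then have "Max (b ` {m..<m+N0}) \<le> e / real m"
      using N0_pos by (subst Max_le_iff) auto
    then have first: "(\<Sum>n=m..2*m. \<bar>b n - b (Suc n)\<bar>) \<le> M * (e / real m)"
      using variation[of m] less.prems M_pos mult_left_mono[of "Max (b ` {m..<m+N0})" "e / real m" M]
      by simp
    have rest: "(\<Sum>n=2*m..<N. \<bar>b n - b (Suc n)\<bar>) \<le> 2 * M * e / real (2 * m)"
      using less.prems False by (intro less.hyps) auto
    \<comment> \<open>The two ranges may share the index \<open>2*m\<close>; counting it twice only
      enlarges the bound.\<close>
    have "(\<Sum>n=m..<N. \<bar>b n - b (Suc n)\<bar>) \<le> (\<Sum>n\<in>{m..2*m} \<union> {2*m..<N}. \<bar>b n - b (Suc n)\<bar>)"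
      by (intro sum_mono2) auto
    also have "\<dots> \<le> (\<Sum>n=m..2*m. \<bar>b n - b (Suc n)\<bar>) + (\<Sum>n=2*m..<N. \<bar>b n - b (Suc n)\<bar>)"
      by (subst sum_Un) (auto intro!: sum_nonneg)
    also have "\<dots> \<le> M * (e / real m) + 2 * M * e / real (2 * m)"
      using first rest by linarith
    also have "\<dots> = 2 * M * e / real m"
      by (simp add: field_simps)
    finally show ?thesis .
  qed
qed

text \<open>The constant is 2 for the part with \<open>n * s \<le> 1\<close> plus
  \<open>1 + 2 * M\<close> for the part beyond, where \<open>s = \<bar>sin (x / 2)\<bar>\<close>. It
  depends on neither \<open>x\<close> nor \<open>N\<close>, which is what uniform convergence
  requires.\<close>

lemma sine_block_le:
  assumes "e \<ge> 0" and small: "\<And>n. n \<ge> m0 \<Longrightarrow> real n * b n \<le> e" and m: "m \<ge> m0" "m \<ge> 1"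
  shows "\<bar>\<Sum>n=m..N. b n * sin (real n * x)\<bar> \<le> (3 + 2 * M) * e"
proof (cases "sin (x / 2) = 0")
  case True
  have "sin (real n * x) = 0" for n
    using abs_sin_of_nat_mult_le[of "2 * n" "x / 2"] True by simp
  with assms M_pos show ?thesis by simp
next
  case False
  define s where "s = \<bar>sin (x / 2)\<bar>"
  have s: "s > 0" using False by (simp add: s_def)
  have low: "\<bar>\<Sum>n=m..N. b n * sin (real n * x)\<bar> \<le> 2 * e" if "real N * s \<le> 1" for N
  proof -
    have "\<bar>\<Sum>n=m..N. b n * sin (real n * x)\<bar> \<le> (\<Sum>n=m..N. \<bar>b n * sin (real n * x)\<bar>)"
      by (rule sum_abs)
    also have "\<dots> \<le> (\<Sum>n=m..N. 2 * e * s)"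
    proof (rule sum_mono)
      fix n assume n: "n \<in> {m..N}"
      have "\<bar>b n * sin (real n * x)\<bar> \<le> b n * (2 * real n * s)"
        \<comment> \<open>Reading \<open>n * x\<close> as \<open>2 * n\<close> times
          \<open>x / 2\<close> gives a bound in terms of \<open>s\<close>.\<close>
        using abs_sin_of_nat_mult_le[of "2 * n" "x / 2"] nonneg[of n] n m
        by (auto simp: abs_mult s_def intro!: mult_left_mono)
      also have "\<dots> = 2 * (real n * b n) * s" by simp
      also have "\<dots> \<le> 2 * e * s"
        using small[of n] n m s by (intro mult_right_mono) auto
      finally show "\<bar>b n * sin (real n * x)\<bar> \<le> 2 * e * s" .
    qed
    also have "\<dots> = real (Suc N - m) * (2 * e * s)"
      by simp
    also have "\<dots> \<le> real N * (2 * e * s)"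
      using m s \<open>e \<ge> 0\<close> by (intro mult_right_mono) auto
    also have "\<dots> = 2 * e * (real N * s)"
      by simp
    also have "\<dots> \<le> 2 * e * 1"
      using that \<open>e \<ge> 0\<close> by (intro mult_left_mono) auto
    finally show ?thesis by simp
  qed
  have high: "\<bar>\<Sum>n=p..N. b n * sin (real n * x)\<bar> \<le> (1 + 2 * M) * e"
    if p: "p \<ge> m" "real p * s \<ge> 1" for p
  proof (cases "p \<le> N")
    case True
    have p1: "p \<ge> 1" "p \<ge> m0" using p m by auto
    have "\<bar>\<Sum>n=p..N. sin (real n * x) * b n\<bar>
        \<le> (1 / s) * (\<bar>b N\<bar> + (\<Sum>n=p..<N. \<bar>b n - b (Suc n)\<bar>))"
      using True
    proof (rule abel_summation_bound)
      fix k assume "p \<le> k"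
      then show "\<bar>\<Sum>n=p..k. sin (real n * x)\<bar> \<le> 1 / s"
        using abs_sum_sin_le[of p k x] s by (simp add: s_def field_simps)
    qed
    also have "\<dots> \<le> (1 / s) * (e / real p + 2 * M * e / real p)"
    proof (intro mult_left_mono add_mono)
      have "real p * b N \<le> real N * b N"
        using True nonneg[of N] p1 by (intro mult_right_mono) auto
      also have "\<dots> \<le> e" using small[of N] True p1 by auto
      finally show "\<bar>b N\<bar> \<le> e / real p"
        using p1 nonneg[of N] True by (simp add: field_simps)
      show "(\<Sum>n=p..<N. \<bar>b n - b (Suc n)\<bar>) \<le> 2 * M * e / real p"
        using \<open>e \<ge> 0\<close> small p1 by (intro tail_variation_le[of e m0]) auto
    qed (use s in auto)
    also have "\<dots> = (1 + 2 * M) * e * (1 / (real p * s))"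
      using s p1 by (simp add: field_simps)
    also have "\<dots> \<le> (1 + 2 * M) * e * 1"
      using p s p1 \<open>e \<ge> 0\<close> M_pos by (intro mult_left_mono) (auto simp: field_simps)
    finally show ?thesis by (simp add: mult.commute)
  qed (use \<open>e \<ge> 0\<close> M_pos in auto)
  \<comment> \<open>The last index with \<open>q * s \<le> 1\<close>: \<open>low\<close> applies up
    to \<open>q\<close>, \<open>high\<close> from \<open>Suc q\<close> on.\<close>
  define q where "q = nat \<lfloor>1 / s\<rfloor>"
  have "real q \<le> 1 / s" "1 / s \<le> real (Suc q)"
    using s unfolding q_def by (auto simp: le_nat_iff) linarith+
  then have q: "real q * s \<le> 1" "1 \<le> real (Suc q) * s"
    using s by (auto simp: field_simps)
  consider "N \<le> q" | "m > q" | "m \<le> q" "q < N" by linarith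
  then show ?thesis
  proof cases
    case 1
    then have "real N * s \<le> real q * s" using s by (intro mult_right_mono) auto
    then show ?thesis
      using low[of N] q mult_right_mono[of 2 "3 + 2 * M" e] M_pos \<open>e \<ge> 0\<close> by linarith
  next
    case 2
    then have "real (Suc q) * s \<le> real m * s" using s by (intro mult_right_mono) auto
    then show ?thesis
      using high[of m] q mult_right_mono[of "1 + 2 * M" "3 + 2 * M" e] \<open>e \<ge> 0\<close> by linarith
  next
    case 3
    then have "{m..N} = {m..q} \<union> {Suc q..N}" by auto
    then have "(\<Sum>n=m..N. b n * sin (real n * x))
        = (\<Sum>n=m..q. b n * sin (real n * x)) + (\<Sum>n=Suc q..N. b n * sin (real n * x))"
      by (simp add: sum.union_disjoint)
    moreover have "\<bar>\<Sum>n=m..q. b n * sin (real n * x)\<bar> \<le> 2 * e" using low q by blast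
    moreover have "\<bar>\<Sum>n=Suc q..N. b n * sin (real n * x)\<bar> \<le> (1 + 2 * M) * e"
      using high[of "Suc q"] q 3 by simp
    moreover have "(3 + 2 * M) * e = 2 * e + (1 + 2 * M) * e" by (simp add: algebra_simps)
    ultimately show ?thesis by linarith
  qed
qed

lemma uniformly_convergent_if_tendsto_0:
  assumes "(\<lambda>n. real n * b n) \<longlonglongrightarrow> 0"
  shows "uniformly_convergent_on UNIV (\<lambda>N x. \<Sum>n=1..N. b n * sin (real n * x))"
proof (rule uniformly_convergent_on_sumI)
  fix e :: real assume "e > 0"
  define d where "d = e / (2 * (3 + 2 * M))"
  have d: "d > 0" "(3 + 2 * M) * d < e"
    using \<open>e > 0\<close> M_pos by (auto simp: d_def divide_simps)
  obtain m0 where m0: "\<And>n. n \<ge> m0 \<Longrightarrow> \<bar>real n * b n\<bar> < d"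
    using LIMSEQ_D[OF assms d(1)] by auto
  have "\<bar>\<Sum>n=m..N. b n * sin (real n * x)\<bar> < e" if "m \<ge> max 1 m0" for m N x
  proof -
    have "\<bar>\<Sum>n=m..N. b n * sin (real n * x)\<bar> \<le> (3 + 2 * M) * d"
      using d m0 that by (intro sine_block_le[of d m0]) (auto intro: less_imp_le order.trans[OF abs_ge_self])
    with d show ?thesis by linarith
  qed
  then show "\<exists>m0. \<forall>m\<ge>m0. \<forall>N\<ge>m. \<forall>x\<in>UNIV. \<bar>\<Sum>n=m..N. b n * sin (real n * x)\<bar> < e"
    by blast
qed

end

section \<open>The squared sinc function and Riemann summation\<close>

text \<open>Since \<open>1 < pi / 3\<close>, the cosine stays above 1/2 on the unit
  interval.\<close>

lemma half_le_sin:
  fixes u :: real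
  assumes "0 \<le> u" "u \<le> 1"
  shows "u / 2 \<le> sin u"
proof -
  have "sin 0 - 0 / 2 \<le> sin u - u / 2"
  proof (rule DERIV_nonneg_imp_nondecreasing[OF assms(1)])
    fix t assume t: "0 \<le> t" "t \<le> u"
    then have "cos (pi / 3) \<le> cos t"
      using assms pi_gt3 by (intro cos_monotone_0_pi_le) auto
    then have "cos t - 1 / 2 \<ge> 0"
      by (simp add: cos_60)
    moreover have "((\<lambda>u. sin u - u / 2) has_real_derivative cos t - 1 / 2) (at t)"
      by (auto intro!: derivative_eq_intros)
    ultimately show "\<exists>y. ((\<lambda>u. sin u - u / 2) has_real_derivative y) (at t) \<and> y \<ge> 0"
      by blast
  qed
  then show ?thesis by simp
qed

text \<open>The derivative of the left-hand expression is \<open>u * sin u\<close>. The quadratic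
  bound cancels the \<open>t^2\<close> in the denominator of the derivative of sinc near 0.\<close>

lemma abs_sin_minus_mult_cos_le:
  fixes u :: real
  assumes "0 \<le> u"
  shows "\<bar>sin u - u * cos u\<bar> \<le> u ^ 2"
proof (cases "u = 0")
  case False
  have "\<exists>z>0. z < u \<and> (\<lambda>u. sin u - u * cos u) u - (\<lambda>u. sin u - u * cos u) 0 = (u - 0) * (z * sin z)"
    using assms False by (intro MVT2) (auto intro!: derivative_eq_intros)
  then obtain z where z: "0 < z" "z < u" "sin u - u * cos u = u * (z * sin z)"
    by auto
  have "\<bar>sin u - u * cos u\<bar> = u * (z * \<bar>sin z\<bar>)"
    using z assms by (simp add: abs_mult)
  also have "\<dots> \<le> u * (u * 1)"
    using z assms by (intro mult_left_mono mult_mono) auto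
  finally show ?thesis by (simp add: power2_eq_square)
qed simp

text \<open>The derivative of the squared sinc is dominated by that of \<open>8 * arctan\<close>.
  Comparing with a bounded monotone function lets variations telescope to a bound independent of the
  step.\<close>

lemma sinc_square_diff_le:
  fixes u v :: real
  assumes "0 < u" "u \<le> v"
  shows "\<bar>(sin u / u)^2 - (sin v / v)^2\<bar> \<le> 8 * (arctan v - arctan u)"
proof -
  define D where "D t = 2 * (sin t / t) * ((cos t * t - sin t) / t^2)" for t :: real
  have D: "((\<lambda>t. (sin t / t)^2) has_real_derivative D t) (at t)" if "t > 0" for t
    using that unfolding D_def
    by (auto intro!: derivative_eq_intros simp: divide_simps)
       (simp add: power2_eq_square power4_eq_xxxx algebra_simps)
  have D_le: "\<bar>D t\<bar> \<le> 8 * inverse (1 + t^2)" if t: "t > 0" for t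
  proof -
    have abs_D: "\<bar>D t\<bar> = 2 * (\<bar>sin t\<bar> / t) * (\<bar>sin t - t * cos t\<bar> / t^2)"
      using t by (simp add: D_def abs_mult abs_minus_commute mult.commute)
    show ?thesis
    \<comment> \<open>Up to 1 the derivative is at most 2, beyond 1 at most \<open>4 / t^2\<close>;
      both lie below \<open>8 / (1 + t^2)\<close>.\<close>
    proof (cases "t \<le> 1")
      case True
      have "\<bar>D t\<bar> \<le> 2 * 1 * 1"
        unfolding abs_D
        using t abs_sin_x_le_abs_x[of t] abs_sin_minus_mult_cos_le[of t]
        by (intro mult_mono) auto
      also have "\<dots> \<le> 8 * inverse (1 + t^2)"
        using True t power_le_one[of t 2] by (simp add: field_simps add_pos_nonneg)
      finally show ?thesis .
    next
      case False
      have "\<bar>sin t - t * cos t\<bar> \<le> \<bar>sin t\<bar> + \<bar>t * cos t\<bar>"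
        by (rule abs_triangle_ineq4)
      also have "\<dots> \<le> 1 + t * 1"
        using t by (intro add_mono) (auto simp: abs_mult)
      also have "\<dots> \<le> 2 * t" using False by simp
      finally have "\<bar>sin t - t * cos t\<bar> \<le> 2 * t" .
      then have "\<bar>D t\<bar> \<le> 2 * (1 / t) * (2 * t / t^2)"
        unfolding abs_D using t by (intro mult_mono divide_right_mono) auto
      also have "\<dots> = 4 / t^2" using t by (simp add: power2_eq_square)
      also have "\<dots> \<le> 8 * inverse (1 + t^2)"
        using False t one_le_power[of t 2] by (simp add: field_simps add_pos_nonneg)
      finally show ?thesis .
    qed
  qed
  \<comment> \<open>Monotonicity of \<open>8 * arctan\<close> minus and plus the squared sinc gives
    the two sides of the absolute value.\<close>
  have "8 * arctan u - (sin u / u)^2 \<le> 8 * arctan v - (sin v / v)^2"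
  proof (rule DERIV_nonneg_imp_nondecreasing[OF assms(2)])
    fix t assume "u \<le> t" "t \<le> v"
    then have "t > 0" using assms by simp
    then show "\<exists>y. ((\<lambda>t. 8 * arctan t - (sin t / t)^2) has_real_derivative y) (at t) \<and> y \<ge> 0"
      using D_le[of t]
      by (intro exI[of _ "8 * inverse (1 + t^2) - D t"] conjI DERIV_diff DERIV_cmult DERIV_arctan D) auto
  qed
  moreover have "8 * arctan u + (sin u / u)^2 \<le> 8 * arctan v + (sin v / v)^2"
  proof (rule DERIV_nonneg_imp_nondecreasing[OF assms(2)])
    fix t assume "u \<le> t" "t \<le> v"
    then have "t > 0" using assms by simp
    then show "\<exists>y. ((\<lambda>t. 8 * arctan t + (sin t / t)^2) has_real_derivative y) (at t) \<and> y \<ge> 0"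
      using D_le[of t]
      by (intro exI[of _ "8 * inverse (1 + t^2) + D t"] conjI DERIV_add DERIV_cmult DERIV_arctan D) auto
  qed
  ultimately show ?thesis by (auto simp: abs_le_iff algebra_simps)
qed

lemma sinc_square_variation_le:
  fixes h :: real
  assumes "h > 0" "m \<ge> 1" "m \<le> N"
  shows "(\<Sum>n=m..<N. \<bar>(sin (real n * h) / (real n * h))^2 -
            (sin (real (Suc n) * h) / (real (Suc n) * h))^2\<bar>) \<le> 8 * pi"
proof -
  have "(\<Sum>n=m..<N. \<bar>(sin (real n * h) / (real n * h))^2 -
            (sin (real (Suc n) * h) / (real (Suc n) * h))^2\<bar>)
      \<le> (\<Sum>n=m..<N. 8 * (arctan (real (Suc n) * h) - arctan (real n * h)))"
    using assms by (intro sum_mono sinc_square_diff_le) auto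
  also have "\<dots> = 8 * (arctan (real N * h) - arctan (real m * h))"
    using sum_Suc_diff'[OF assms(3), of "\<lambda>n. arctan (real n * h)"]
    by (simp only: flip: sum_distrib_left)
  also have "\<dots> \<le> 8 * pi"
    using arctan_ubound[of "real N * h"] arctan_lbound[of "real m * h"] by simp
  finally show ?thesis .
qed

lemma sin_over_self_tendsto: "((\<lambda>u::real. sin u / u) \<longlongrightarrow> 1) (at 0)"
  using DERIV_sin[of "0::real"] by (simp add: DERIV_def)

text \<open>Riemann's summation method is regular: the factors have variation bounded uniformly
  in \<open>h\<close>, so Abel summation makes the series converge uniformly in \<open>h\<close>.\<close>

lemma riemann_summation_regular:
  fixes a :: "nat \<Rightarrow> real"
  assumes a: "(\<lambda>N. \<Sum>n=1..N. a n) \<longlonglongrightarrow> s"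
    and g: "\<And>h. h \<noteq> 0 \<Longrightarrow>
      (\<lambda>N. \<Sum>n=1..N. a n * (sin (real n * h) / (real n * h))^2) \<longlonglongrightarrow> g h"
  shows "(g \<longlongrightarrow> s) (at 0)"
proof -
  define c where "c h n = (sin (real n * h) / (real n * h))^2" for h :: real and n :: nat
  \<comment> \<open>Evenness in \<open>h\<close> reduces the variation bound to positive
    steps.\<close>
  have c_abs: "c \<bar>h\<bar> n = c h n" for h n
    by (cases "h \<ge> 0") (auto simp: c_def)
  have c_le: "\<bar>c h n\<bar> \<le> 1" for h n
  proof (cases "real n * h = 0")
    case False
    then have "\<bar>sin (real n * h) / (real n * h)\<bar> \<le> 1"
      using abs_sin_x_le_abs_x[of "real n * h"] by (simp add: field_simps)
    then have "(sin (real n * h) / (real n * h))^2 \<le> 1"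
      by (simp only: abs_square_le_1)
    then show ?thesis by (simp add: c_def)
  qed (auto simp: c_def)
  \<comment> \<open>The point 0 is left out: division by zero makes \<open>c 0 n\<close> equal to 0
    instead of the limit 1.\<close>
  have "uniformly_convergent_on (-{0}) (\<lambda>N h. \<Sum>n=1..N. a n * c h n)"
  proof (rule uniformly_convergent_on_sumI)
    fix e :: real assume "e > 0"
    define d where "d = e / (2 * (1 + 8 * pi))"
    have K: "1 + 8 * pi > 0" using pi_gt_zero by linarith
    then have d: "d > 0" "d * (1 + 8 * pi) < e"
      using \<open>e > 0\<close> by (auto simp: d_def divide_simps)
    from a have "Cauchy (\<lambda>N. \<Sum>n=1..N. a n)" by (rule LIMSEQ_imp_Cauchy)
    then obtain m0 where m0: "\<And>m N. m \<ge> m0 \<Longrightarrow> N \<ge> m0 \<Longrightarrow> \<bar>(\<Sum>n=1..m. a n) - (\<Sum>n=1..N. a n)\<bar> < d"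
      using d(1) unfolding Cauchy_def dist_real_def by blast
    \<comment> \<open>Starting at \<open>Suc m0\<close> keeps \<open>m - 1\<close> in the range of
      the Cauchy estimate and \<open>m\<close> positive.\<close>
    have "\<bar>\<Sum>n=m..N. a n * c h n\<bar> < e" if m: "m \<ge> Suc m0" "N \<ge> m" and h: "h \<noteq> 0" for m N h
    proof -
      have "\<bar>\<Sum>n=m..N. a n * c h n\<bar> \<le> d * (\<bar>c h N\<bar> + (\<Sum>n=m..<N. \<bar>c h n - c h (Suc n)\<bar>))"
      proof (rule abel_summation_bound[OF m(2)])
        fix k assume k: "m \<le> k" "k \<le> N"
        have "{1..k} = {1..m-1} \<union> {m..k}" using m k by auto
        then have "(\<Sum>n=1..k. a n) = (\<Sum>n=1..m-1. a n) + (\<Sum>n=m..k. a n)"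
          by (simp add: sum.union_disjoint)
        moreover have "\<bar>(\<Sum>n=1..k. a n) - (\<Sum>n=1..m-1. a n)\<bar> < d"
          using m k by (intro m0) auto
        ultimately show "\<bar>\<Sum>n=m..k. a n\<bar> \<le> d"
          by linarith
      qed
      also have "\<dots> \<le> d * (1 + 8 * pi)"
      proof -
        have "(\<Sum>n=m..<N. \<bar>c \<bar>h\<bar> n - c \<bar>h\<bar> (Suc n)\<bar>) \<le> 8 * pi"
          using sinc_square_variation_le[of "\<bar>h\<bar>" m N] m h unfolding c_def by simp
        then show ?thesis
          using c_le[of h N] d by (intro mult_left_mono add_mono) (auto simp: c_abs)
      qed
      also have "\<dots> < e" by (rule d)
      finally show ?thesis .
    qed
    then show "\<exists>m0. \<forall>m\<ge>m0. \<forall>N\<ge>m. \<forall>h\<in>-{0}. \<bar>\<Sum>n=m..N. a n * c h n\<bar> < e"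
      by blast
  qed
  then obtain l where l: "uniform_limit (-{0}) (\<lambda>N h. \<Sum>n=1..N. a n * c h n) l sequentially"
    unfolding uniformly_convergent_on_def by blast
  have c_lim: "((\<lambda>h. c h n) \<longlongrightarrow> 1) (at 0)" if "n \<ge> 1" for n
  proof -
    have "filterlim (\<lambda>h. real n * h) (at 0) (at 0)"
      using that unfolding filterlim_at
      by (auto intro!: tendsto_eq_intros simp: eventually_at_filter)
    from filterlim_compose[OF sin_over_self_tendsto this]
    have "((\<lambda>h. sin (real n * h) / (real n * h)) \<longlongrightarrow> 1) (at 0)" .
    from tendsto_power[OF this, of 2] show ?thesis by (simp add: c_def)
  qed
  \<comment> \<open>Uniformity in \<open>h\<close> allows the limits in \<open>N\<close> and in
    \<open>h\<close> to be interchanged.\<close>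
  have "(l \<longlongrightarrow> s) (at 0)"
  proof (rule swap_uniform_limit'[OF _ a l])
    have "((\<lambda>h. \<Sum>n=1..N. a n * c h n) \<longlongrightarrow> (\<Sum>n=1..N. a n * 1)) (at 0)" for N
      by (intro tendsto_sum tendsto_mult tendsto_const c_lim) auto
    then show "\<forall>\<^sub>F N in sequentially. ((\<lambda>h. \<Sum>n=1..N. a n * c h n) \<longlongrightarrow> (\<Sum>n=1..N. a n)) (at 0)"
      by simp
  qed (auto simp: eventually_at_filter)
  moreover have "l h = g h" if "h \<noteq> 0" for h
    using tendsto_uniform_limitI[OF l, of h] g[OF that] that
    unfolding c_def by (auto intro: LIMSEQ_unique)
  ultimately show ?thesis
    by (elim Lim_transform_eventually) (simp add: eventually_at_filter)
qed

section \<open>A maximum principle for symmetric second derivatives\<close>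

text \<open>Schwarz's argument: subtract a parabola with second derivative \<open>c\<close>. If the
  bound failed, the difference would have an interior minimum, where its symmetric second derivative
  is nonnegative but equals \<open>f y - c < 0\<close>.\<close>

lemma symmetric_second_derivative_bound:
  fixes F f :: "real \<Rightarrow> real"
  assumes cont: "continuous_on {x - H..x + H} F" and "H > 0"
    and deriv: "\<And>y. \<bar>y - x\<bar> < H \<Longrightarrow>
      ((\<lambda>t. (F (y + t) + F (y - t) - 2 * F y) / t^2) \<longlongrightarrow> f y) (at 0)"
    and bound: "\<And>y. \<bar>y - x\<bar> < H \<Longrightarrow> f y < c"
  shows "F (x + H) + F (x - H) - 2 * F x \<le> c * H^2"
proof (rule ccontr)
  assume neg: "\<not> ?thesis"
  \<comment> \<open>The slope of the chord, chosen so that \<open>D\<close> takes equal values at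
    both ends.\<close>
  define p where "p = (F (x + H) - F (x - H)) / (2 * H)"
  define D where "D y = F y - c / 2 * (y - x)^2 - p * (y - x)" for y
  have end_pts: "D (x + H) = D (x - H)"
    using \<open>H > 0\<close> by (simp add: D_def p_def field_simps)
  have "D (x + H) + D (x - H) > 2 * D x"
    using neg by (simp add: D_def field_simps)
  with end_pts have centre: "D x < D (x + H)" "D x < D (x - H)" by auto
  have "continuous_on {x - H..x + H} D"
    unfolding D_def by (intro continuous_intros cont)
  then obtain y where y: "y \<in> {x - H..x + H}" "\<And>z. z \<in> {x - H..x + H} \<Longrightarrow> D y \<le> D z"
    using continuous_attains_inf[of "{x - H..x + H}" D] \<open>H > 0\<close> by auto
  have "D y \<le> D x" using y \<open>H > 0\<close> by auto
  with centre have "y \<noteq> x + H" "y \<noteq> x - H" by auto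
  with y have int: "\<bar>y - x\<bar> < H" by auto
  have "((\<lambda>t. (D (y + t) + D (y - t) - 2 * D y) / t^2) \<longlongrightarrow> f y - c) (at 0)"
  proof (rule Lim_transform_eventually)
    show "((\<lambda>t. (F (y + t) + F (y - t) - 2 * F y) / t^2 - c) \<longlongrightarrow> f y - c) (at 0)"
      by (intro tendsto_diff deriv int tendsto_const)
    have "(F (y + t) + F (y - t) - 2 * F y) / t^2 - c = (D (y + t) + D (y - t) - 2 * D y) / t^2"
      if "t \<noteq> 0" for t :: real
      using that by (simp add: D_def divide_simps) (simp add: power2_eq_square algebra_simps)
    then show "\<forall>\<^sub>F t in at 0. (F (y + t) + F (y - t) - 2 * F y) / t^2 - c
        = (D (y + t) + D (y - t) - 2 * D y) / t^2"
      by (auto simp: eventually_at_filter)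
  qed
  moreover have "\<forall>\<^sub>F t in at 0. 0 \<le> (D (y + t) + D (y - t) - 2 * D y) / t^2"
    unfolding eventually_at
  proof (intro exI[of _ "H - \<bar>y - x\<bar>"] conjI ballI impI)
    fix t :: real assume "t \<noteq> 0 \<and> dist t 0 < H - \<bar>y - x\<bar>"
    then have "y + t \<in> {x - H..x + H}" "y - t \<in> {x - H..x + H}" by (auto simp: dist_real_def)
    from y(2)[OF this(1)] y(2)[OF this(2)]
    show "0 \<le> (D (y + t) + D (y - t) - 2 * D y) / t^2" by (intro divide_nonneg_nonneg) auto
  qed (use int in auto)
  ultimately have "0 \<le> f y - c"
    by (intro tendsto_lowerbound) auto
  with bound[OF int] show False by simp
qed

section \<open>The Cantor-Lebesgue theorem for sine series\<close>

lemma has_integral_sin_of_nat_square: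
  assumes "n \<ge> 1"
  shows "((\<lambda>x. (sin (real n * x))^2) has_integral pi) {0..2 * pi}"
proof -
  have "((\<lambda>x. (sin (real n * x))^2) has_integral
      ((2 * pi) / 2 - sin (real (2 * n) * (2 * pi)) / (4 * real n)) - (0 / 2 - sin (real (2 * n) * 0) / (4 * real n)))
      {0..2 * pi}"
  proof (rule fundamental_theorem_of_calculus)
    fix x :: real
    have "((\<lambda>x. x / 2 - sin (real (2 * n) * x) / (4 * real n)) has_real_derivative
        1 / 2 - cos (2 * (real n * x)) / 2) (at x)"
      using assms by (auto intro!: derivative_eq_intros simp: field_simps)
    also have "1 / 2 - cos (2 * (real n * x)) / 2 = (sin (real n * x))^2"
      unfolding cos_double_sin by (simp add: field_simps)
    finally show "((\<lambda>x. x / 2 - sin (real (2 * n) * x) / (4 * real n)) has_vector_derivative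
        (sin (real n * x))^2) (at x within {0..2 * pi})"
      by (meson has_real_derivative_iff_has_vector_derivative has_vector_derivative_at_within)
  qed simp
  moreover have "sin (real (2 * n) * (2 * pi)) = 0"
    using sin_npi[of "4 * n"] by (simp add: mult_ac)
  ultimately show ?thesis by simp
qed

text \<open>If \<open>\<bar>b n\<bar> \<ge> e\<close> along a subsequence, the sines along it tend
  to 0 at every point. Dominated convergence then contradicts that their squares all have integral
  \<open>pi\<close> over a period.\<close>

lemma cantor_lebesgue_sin:
  fixes b :: "nat \<Rightarrow> real"
  assumes lim: "\<And>x. (\<lambda>n. b n * sin (real n * x)) \<longlonglongrightarrow> 0"
  shows "b \<longlonglongrightarrow> 0"
proof (rule ccontr)
  assume "\<not> ?thesis"
  then obtain e where e: "e > 0" and "\<And>N. \<exists>n\<ge>N. \<bar>b n\<bar> \<ge> e"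
    unfolding LIMSEQ_iff by (auto simp: not_less)
  then have "\<forall>N. \<exists>n. n \<ge> Suc N \<and> \<bar>b n\<bar> \<ge> e" by blast
  then obtain r where r: "\<And>N. r N \<ge> Suc N" "\<And>N. \<bar>b (r N)\<bar> \<ge> e" by metis
  have "filterlim r at_top sequentially"
    using r(1) by (intro filterlim_at_top_mono[OF filterlim_ident]) (simp add: Suc_leD)
  have "((\<lambda>x. 0) has_integral pi) {0..2 * pi}"
  proof (rule has_integral_dominated_convergence)
    show "((\<lambda>x. (sin (real (r k) * x))^2) has_integral pi) {0..2 * pi}" for k
      using r(1)[of k] by (intro has_integral_sin_of_nat_square) simp
    show "(\<lambda>x. 1::real) integrable_on {0..2 * pi}" by (rule integrable_const_ivl)
    show "\<forall>x\<in>{0..2*pi}. norm ((sin (real (r k) * x))^2) \<le> 1" for k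
      by (simp add: abs_square_le_1)
    show "\<forall>x\<in>{0..2*pi}. (\<lambda>k. (sin (real (r k) * x))^2) \<longlonglongrightarrow> 0"
    proof
      fix x :: real
      have "(\<lambda>k. b (r k) * sin (real (r k) * x)) \<longlonglongrightarrow> 0"
        using filterlim_compose[OF lim \<open>filterlim r at_top sequentially\<close>] .
      then have "(\<lambda>k. \<bar>b (r k) * sin (real (r k) * x)\<bar> / e) \<longlonglongrightarrow> 0"
        by (intro tendsto_divide_zero tendsto_rabs_zero)
      then have "(\<lambda>k. sin (real (r k) * x)) \<longlonglongrightarrow> 0"
      proof (rule Lim_null_comparison[rotated], intro always_eventually allI)
        fix k
        have "e * \<bar>sin (real (r k) * x)\<bar> \<le> \<bar>b (r k)\<bar> * \<bar>sin (real (r k) * x)\<bar>"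
          using r(2) by (intro mult_right_mono) auto
        then show "norm (sin (real (r k) * x)) \<le> \<bar>b (r k) * sin (real (r k) * x)\<bar> / e"
          using e by (simp add: abs_mult field_simps)
      qed
      from tendsto_power[OF this, of 2] show "(\<lambda>k. (sin (real (r k) * x))^2) \<longlonglongrightarrow> 0" by simp
    qed
  qed simp
  then have "pi = 0" using has_integral_unique[OF has_integral_0] by metis
  then show False by simp
qed

lemma LIMSEQ_sum_from_1_iff_sums:
  fixes a :: "nat \<Rightarrow> real"
  assumes "a 0 = 0"
  shows "(\<lambda>N. \<Sum>n=1..N. a n) \<longlonglongrightarrow> s \<longleftrightarrow> a sums s"
proof -
  have "{..N} = insert 0 {1..N}" for N :: nat by auto
  then have "(\<Sum>n=1..N. a n) = (\<Sum>n\<le>N. a n)" for N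
    using assms by simp
  then show ?thesis by (simp add: sums_def_le)
qed

section \<open>The twice integrated series and its second differences\<close>

locale everywhere_convergent_sine_series =
  fixes b :: "nat \<Rightarrow> real"
  assumes conv: "summable (\<lambda>n. b n * sin (real n * x))"
begin

text \<open>Summation may start at 0 whatever \<open>b 0\<close> is, because the sine factor
  vanishes there.\<close>

definition f :: "real \<Rightarrow> real" where
  "f x = (\<Sum>n. b n * sin (real n * x))"

definition F :: "real \<Rightarrow> real" where
  "F x = (\<Sum>n. - (b n * sin (real n * x) / (real n)^2))"

lemma coefficients_tendsto_0: "b \<longlonglongrightarrow> 0"
  by (rule cantor_lebesgue_sin) (rule summable_LIMSEQ_zero[OF conv])

lemma uniform_limit_F:
  "uniform_limit UNIV (\<lambda>N x. \<Sum>n<N. - (b n * sin (real n * x) / (real n)^2)) F sequentially"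
proof -
  obtain B where B: "\<And>n. \<bar>b n\<bar> \<le> B"
    using convergent_imp_Bseq[OF convergentI[OF coefficients_tendsto_0]]
    unfolding Bseq_def by auto
  have "norm (- (b n * sin (real n * x) / (real n)^2)) \<le> B * inverse ((real n)^2)" for n x
  proof -
    have "\<bar>b n\<bar> * \<bar>sin (real n * x)\<bar> \<le> B * 1"
      using B by (intro mult_mono) (auto intro: order_trans[OF abs_ge_zero])
    then show ?thesis
      by (simp add: abs_mult divide_inverse mult_right_mono)
  qed
  moreover have "summable (\<lambda>n. B * inverse ((real n)^2))"
    by (intro summable_mult inverse_power_summable) simp
  ultimately have "uniform_limit UNIV (\<lambda>N x. \<Sum>n<N. - (b n * sin (real n * x) / (real n)^2))
      (\<lambda>x. \<Sum>n. - (b n * sin (real n * x) / (real n)^2)) sequentially"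
    by (rule Weierstrass_m_test)
  then show ?thesis by (simp only: F_def[abs_def])
qed

lemma continuous_on_F: "continuous_on S F"
proof -
  have "continuous_on UNIV F"
    by (rule uniform_limit_theorem[OF _ uniform_limit_F])
       (auto simp: divide_inverse intro!: always_eventually continuous_intros)
  then show ?thesis by (rule continuous_on_subset) simp
qed

text \<open>The second difference of \<open>sin (n x)\<close> is
  \<open>-4 * sin (n x) * (sin (n t / 2))^2\<close>, so dividing by \<open>- n^2 * t^2\<close>
  leaves a squared sinc: exactly the factor of Riemann summation.\<close>

lemma F_term_second_difference:
  assumes "t \<noteq> 0"
  shows "(- (b n * sin (real n * (x + t)) / (real n)^2) + - (b n * sin (real n * (x - t)) / (real n)^2)
            - 2 * - (b n * sin (real n * x) / (real n)^2)) / t^2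
       = b n * sin (real n * x) * (sin (real n * (t / 2)) / (real n * (t / 2)))^2"
proof (cases "n = 0")
  case False
  have "sin (real n * (x + t)) + sin (real n * (x - t)) = 2 * sin (real n * x) * cos (2 * (real n * (t / 2)))"
    by (simp add: distrib_left right_diff_distrib sin_add sin_diff)
  also have "\<dots> = 2 * sin (real n * x) - 4 * sin (real n * x) * (sin (real n * (t / 2)))^2"
    unfolding cos_double_sin by (simp add: algebra_simps)
  finally have eq: "sin (real n * (x - t)) = 2 * sin (real n * x)
      - 4 * sin (real n * x) * (sin (real n * (t / 2)))^2 - sin (real n * (x + t))"
    by simp
  show ?thesis
    unfolding eq using False assms by (simp add: field_simps)
qed simp

lemma F_symmetric_second_derivative:
  "((\<lambda>t. (F (x + t) + F (x - t) - 2 * F x) / t^2) \<longlongrightarrow> f x) (at 0)"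
proof -
  have F: "(\<lambda>n. - (b n * sin (real n * x) / (real n)^2)) sums F x" for x
    using tendsto_uniform_limitI[OF uniform_limit_F] by (simp add: sums_def)
  \<comment> \<open>With \<open>t = 2 * h\<close> the half step \<open>t / 2\<close> becomes the
    parameter of Riemann summation.\<close>
  have "((\<lambda>h. (F (x + 2 * h) + F (x - 2 * h) - 2 * F x) / (2 * h)^2) \<longlongrightarrow> f x) (at 0)"
  proof (rule riemann_summation_regular)
    show "(\<lambda>N. \<Sum>n=1..N. b n * sin (real n * x)) \<longlonglongrightarrow> f x"
      using conv by (subst LIMSEQ_sum_from_1_iff_sums) (auto simp: f_def)
    fix h :: real assume h: "h \<noteq> 0"
    have "(\<lambda>n. (- (b n * sin (real n * (x + 2 * h)) / (real n)^2) + - (b n * sin (real n * (x - 2 * h)) / (real n)^2)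
            - 2 * - (b n * sin (real n * x) / (real n)^2)) / (2 * h)^2) sums
          ((F (x + 2 * h) + F (x - 2 * h) - 2 * F x) / (2 * h)^2)"
      by (intro sums_divide sums_diff sums_add sums_mult F)
    then have "(\<lambda>n. b n * sin (real n * x) * (sin (real n * h) / (real n * h))^2) sums
          ((F (x + 2 * h) + F (x - 2 * h) - 2 * F x) / (2 * h)^2)"
      using h by (subst (asm) F_term_second_difference) auto
    then show "(\<lambda>N. \<Sum>n=1..N. b n * sin (real n * x) * (sin (real n * h) / (real n * h))^2)
        \<longlonglongrightarrow> (F (x + 2 * h) + F (x - 2 * h) - 2 * F x) / (2 * h)^2"
      by (subst LIMSEQ_sum_from_1_iff_sums) auto
  qed
  moreover have "filterlim (\<lambda>t::real. t / 2) (at 0) (at 0)"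
    unfolding filterlim_at by (auto intro!: tendsto_eq_intros simp: eventually_at_filter)
  ultimately have "((\<lambda>t. (F (x + 2 * (t / 2)) + F (x - 2 * (t / 2)) - 2 * F x) / (2 * (t / 2))^2) \<longlongrightarrow> f x) (at 0)"
    by (rule filterlim_compose)
  then show ?thesis by simp
qed

text \<open>Integrating the second difference of \<open>F\<close> with step \<open>h = 1/k\<close> over \<open>0 \<le> x \<le> h\<close> replaces the
  factors \<open>sin (n x)\<close> of varying sign by \<open>(1 - cos (n h)) / n \<ge> 0\<close>, so all terms beyond \<open>n = k\<close> may be
  dropped.\<close>

lemma sum_of_nat_mult_le:
  assumes nonneg: "\<And>n. n \<ge> 1 \<Longrightarrow> b n \<ge> 0"
    and "e > 0" and k: "k \<ge> 1"
    and small: "\<And>y. \<bar>y\<bar> < 2 / real k \<Longrightarrow> f y < e"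
  shows "(\<Sum>n=1..k. real n * b n) \<le> 64 * e * real k"
proof -
  define h where "h = 1 / real k"
  define s where "s n = (sin (real n * (h / 2)) / (real n * (h / 2)))^2" for n
  define G where "G N x = (\<Sum>n<N. - (b n * sin (real n * x) / (real n)^2))" for N x
  have h: "h > 0" using k by (simp add: h_def)
  \<comment> \<open>A second difference has total weight 1 + 1 + 2 = 4, so this accuracy costs at
    most \<open>e * h^2\<close> when \<open>F\<close> is replaced by the partial sum
    \<open>G N\<close>.\<close>
  have "e * h^2 / 4 > 0" using \<open>e > 0\<close> h by simp
  from uniform_limitD[OF uniform_limit_F this]
  have "\<forall>\<^sub>F N in sequentially. \<forall>x. \<bar>G N x - F x\<bar> < e * h^2 / 4 \<and> N > k"
    using eventually_gt_at_top[of k] by eventually_elim (simp add: G_def dist_real_def)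
  then obtain N where N: "\<And>x. \<bar>G N x - F x\<bar> < e * h^2 / 4" "N > k"
    unfolding eventually_sequentially by blast
  \<comment> \<open>The antiderivative, vanishing at 0, of the scaled second difference of
    \<open>G N\<close>. Working with a finite sum allows termwise differentiation and the mean value
    theorem.\<close>
  define K where "K x = (\<Sum>n<N. b n * s n * ((1 - cos (real n * x)) / real n))" for x
  have deriv: "(K has_real_derivative (\<Sum>n<N. b n * s n * sin (real n * x))) (at x)" for x
    unfolding K_def
  proof (rule DERIV_sum)
    fix n
    have "((\<lambda>x. (1 - cos (real n * x)) / real n) has_real_derivative sin (real n * x)) (at x)"
      by (cases "n = 0") (auto intro!: derivative_eq_intros)
    then show "((\<lambda>x. b n * s n * ((1 - cos (real n * x)) / real n)) has_real_derivative
        b n * s n * sin (real n * x)) (at x)"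
      by (rule DERIV_cmult)
  qed
  have deriv_le: "(\<Sum>n<N. b n * s n * sin (real n * x)) \<le> 2 * e" if x: "0 \<le> x" "x \<le> h" for x
  proof -
    have "F (x + h) + F (x - h) - 2 * F x \<le> e * h^2"
    proof (rule symmetric_second_derivative_bound[OF continuous_on_F h F_symmetric_second_derivative])
      \<comment> \<open>Such \<open>y\<close> lies strictly between \<open>-h\<close> and
        \<open>2 * h\<close>, hence within \<open>2 / k\<close> of 0.\<close>
      fix y assume "\<bar>y - x\<bar> < h"
      then show "f y < e" using x by (intro small) (auto simp: h_def)
    qed
    then have "G N (x + h) + G N (x - h) - 2 * G N x \<le> 2 * e * h^2"
      using N(1)[of "x + h"] N(1)[of "x - h"] N(1)[of x] by linarith
    then have "(G N (x + h) + G N (x - h) - 2 * G N x) / h^2 \<le> 2 * e"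
      using h by (simp add: field_simps)
    also have "(G N (x + h) + G N (x - h) - 2 * G N x) / h^2
        = (\<Sum>n<N. (- (b n * sin (real n * (x + h)) / (real n)^2) + - (b n * sin (real n * (x - h)) / (real n)^2)
            - 2 * - (b n * sin (real n * x) / (real n)^2)) / h^2)"
      unfolding G_def
      by (simp only: sum_distrib_left sum.distrib sum_subtractf flip: sum_divide_distrib)
    also have "\<dots> = (\<Sum>n<N. b n * s n * sin (real n * x))"
      using h by (subst F_term_second_difference) (auto simp: s_def mult_ac)
    finally show ?thesis .
  qed
  have "\<exists>z>0. z < h \<and> K h - K 0 = (h - 0) * (\<Sum>n<N. b n * s n * sin (real n * z))"
    using h deriv by (intro MVT2) auto
  then obtain z where z: "0 < z" "z < h" "K h = h * (\<Sum>n<N. b n * s n * sin (real n * z))"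
    by (auto simp: K_def)
  \<comment> \<open>For \<open>n \<le> k\<close>, \<open>s n\<close> is at least 1/4 and
    \<open>1 - cos (n h)\<close> at least \<open>n^2 * h^2 / 8\<close>; dividing by \<open>n\<close>
    gives the factor \<open>n * h^2 / 32\<close>.\<close>
  have "(\<Sum>n=1..k. real n * b n) * (h^2 / 32) \<le> K h"
  proof -
    have "(\<Sum>n=1..k. real n * b n) * (h^2 / 32)
        \<le> (\<Sum>n=1..k. b n * s n * ((1 - cos (real n * h)) / real n))"
      unfolding sum_distrib_right
    proof (rule sum_mono)
      fix n assume n: "n \<in> {1..k}"
      define u where "u = real n * (h / 2)"
      have u: "0 < u" "u \<le> 1" using n h k by (auto simp: u_def h_def field_simps)
      have su: "u / 2 \<le> sin u" using half_le_sin u by simp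
      have "(1/2)^2 \<le> (sin u / u)^2"
        using su u by (intro power_mono) (auto simp: field_simps)
      then have s_ge: "1 / 4 \<le> s n" by (simp add: s_def u_def power2_eq_square)
      have "2 * (u / 2)^2 \<le> 2 * (sin u)^2"
        using su u by (intro mult_left_mono power_mono) auto
      also have "\<dots> = 1 - cos (2 * u)" by (simp add: cos_double_sin)
      finally have "u^2 / 2 \<le> 1 - cos (real n * h)"
        by (simp add: u_def power2_eq_square mult_ac)
      then have "u^2 / 2 / real n \<le> (1 - cos (real n * h)) / real n"
        by (intro divide_right_mono) auto
      then have "b n * (1 / 4) * (u^2 / 2 / real n) \<le> b n * s n * ((1 - cos (real n * h)) / real n)"
        using s_ge nonneg[of n] n by (intro mult_mono mult_nonneg_nonneg) auto
      also have "b n * (1 / 4) * (u^2 / 2 / real n) = real n * b n * (h^2 / 32)"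
        using n by (simp add: u_def power2_eq_square)
      finally show "real n * b n * (h^2 / 32) \<le> b n * s n * ((1 - cos (real n * h)) / real n)" .
    qed
    also have "\<dots> \<le> K h"
      unfolding K_def
    proof (intro sum_mono2)
      fix n assume "n \<in> {..<N} - {1..k}"
      show "0 \<le> b n * s n * ((1 - cos (real n * h)) / real n)"
        using nonneg[of n] by (cases "n = 0") (auto simp: s_def intro!: mult_nonneg_nonneg divide_nonneg_nonneg)
    qed (use N in auto)
    finally show ?thesis .
  qed
  also have "K h \<le> h * (2 * e)"
    unfolding z(3) using z h by (intro mult_left_mono deriv_le) auto
  finally have "(\<Sum>n=1..k. real n * b n) * h \<le> 64 * e"
    using h by (simp add: power2_eq_square field_simps)
  then show ?thesis using k by (simp add: h_def field_simps)
qed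

text \<open>As \<open>f 0 = 0\<close>, continuity makes \<open>f\<close> small on the interval of
  radius \<open>2 / k\<close> for all large \<open>k\<close>.\<close>

lemma mean_tendsto_0_if_continuous:
  assumes nonneg: "\<And>n. n \<ge> 1 \<Longrightarrow> b n \<ge> 0" and cont: "continuous_on UNIV f"
  shows "(\<lambda>k. (\<Sum>n=1..k. real n * b n) / real k) \<longlonglongrightarrow> 0"
proof (rule LIMSEQ_I)
  fix r :: real assume "r > 0"
  define e where "e = r / 128"
  have e: "e > 0" "64 * e < r" using \<open>r > 0\<close> by (auto simp: e_def)
  have "f 0 = 0" by (simp add: f_def)
  then obtain d where d: "d > 0" "\<And>y. \<bar>y\<bar> < d \<Longrightarrow> \<bar>f y\<bar> < e"
    using cont[unfolded continuous_on_iff, rule_format, of 0 e] e(1) by (auto simp: dist_real_def)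
  obtain k0 where k0: "real k0 > 2 / d" using reals_Archimedean2 by blast
  have "norm ((\<Sum>n=1..k. real n * b n) / real k - 0) < r" if k: "k \<ge> Suc k0" for k
  proof -
    have "2 / d < real k" using k0 k by linarith
    then have "2 / real k < d" using d k by (simp add: field_simps)
    then have "(\<Sum>n=1..k. real n * b n) \<le> 64 * e * real k"
      using nonneg e k d(2) by (intro sum_of_nat_mult_le) (auto intro: less_trans abs_less_iff[THEN iffD1, THEN conjunct1])
    then have "(\<Sum>n=1..k. real n * b n) / real k \<le> 64 * e"
      using k by (simp add: field_simps)
    moreover have "0 \<le> (\<Sum>n=1..k. real n * b n) / real k"
      using nonneg by (intro divide_nonneg_nonneg sum_nonneg mult_nonneg_nonneg) auto
    ultimately show ?thesis using e by simp
  qed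
  then show "\<exists>k0. \<forall>k\<ge>k0. norm ((\<Sum>n=1..k. real n * b n) / real k - 0) < r" by blast
qed

end

section \<open>Necessity: from weighted means back to single coefficients\<close>

context dyadic_bounded_variation
begin

text \<open>Variation from \<open>m\<close> to \<open>k\<close> controls \<open>b k - b m\<close>.
  The range reaches \<open>2 * m + 1\<close> because the last difference in the hypothesis involves
  \<open>b (2*m+1)\<close>. A window sum replaces the maximum so that the estimate can be averaged
  over \<open>m\<close>.\<close>

lemma term_le_window_sum:
  assumes "m \<ge> 1" "m \<le> k" "k \<le> 2 * m + 1"
  shows "b k \<le> (1 + M) * (\<Sum>i<N0. b (m + i))"
proof -
  have "b k - b m = (\<Sum>n=m..<k. b (Suc n) - b n)"
    using sum_Suc_diff'[of m k b] assms by simp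
  also have "\<dots> \<le> (\<Sum>n=m..<k. \<bar>b n - b (n + 1)\<bar>)"
    by (intro sum_mono) auto
  also have "\<dots> \<le> (\<Sum>n=m..2*m. \<bar>b n - b (n + 1)\<bar>)"
    using assms by (intro sum_mono2) auto
  also have "\<dots> \<le> M * Max (b ` {m..<m+N0})"
    by (rule variation[OF assms(1)])
  also have "\<dots> \<le> M * (\<Sum>n=m..<m+N0. b n)"
  proof (intro mult_left_mono)
    have "b n \<le> (\<Sum>n=m..<m+N0. b n)" if "n \<in> {m..<m+N0}" for n
      using that assms nonneg by (intro member_le_sum) auto
    then show "Max (b ` {m..<m+N0}) \<le> (\<Sum>n=m..<m+N0. b n)"
      using N0_pos by (subst Max_le_iff) auto
  qed (use M_pos in auto)
  finally have "b k \<le> b m + M * (\<Sum>n=m..<m+N0. b n)" by simp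
  also have "b m \<le> (\<Sum>n=m..<m+N0. b n)"
    using assms nonneg N0_pos by (intro member_le_sum) auto
  also have "(\<Sum>n=m..<m+N0. b n) = (\<Sum>i<N0. b (m + i))"
    using sum.shift_bounds_nat_ivl[of b 0 m N0] by (simp add: lessThan_atLeast0 add.commute)
  finally show ?thesis by (simp add: algebra_simps)
qed

text \<open>Adding the window estimate over about \<open>k / 2\<close> starting points
  \<open>m\<close> gains one factor \<open>k / 2\<close>; the weights
  \<open>m + i \<ge> k / 2\<close> in the mean gain a second. Each of the \<open>N0\<close> shifts
  costs at most one copy of \<open>T\<close>.\<close>

lemma of_nat_mult_le_mean:
  assumes k: "k \<ge> 1"
  shows "real k * b k \<le>
    4 * (1 + M) * real N0 * (1 + real N0) * ((\<Sum>n=1..k+N0. real n * b n) / real (k + N0))"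
proof -
  define T where "T = (\<Sum>n=1..k+N0. real n * b n)"
  \<comment> \<open>Rounding down ensures \<open>k \<le> 2 * m\<close> for
    \<open>m \<ge> k - p\<close>, while \<open>p + 1\<close> starting points still number at least
    \<open>k / 2\<close>.\<close>
  define p where "p = k div 2"
  have T: "T \<ge> 0" unfolding T_def using nonneg by (intro sum_nonneg) auto
  have shifted: "(real k / 2) * (\<Sum>m=k-p..k. b (m + i)) \<le> T" if "i < N0" for i
  proof -
    have "(real k / 2) * (\<Sum>m=k-p..k. b (m + i)) \<le> (\<Sum>m=k-p..k. real (m + i) * b (m + i))"
      unfolding sum_distrib_left
    proof (intro sum_mono mult_right_mono)
      fix m assume m: "m \<in> {k-p..k}"
      then have "k \<le> 2 * m" "m \<ge> 1" using k by (auto simp: p_def)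
      then show "real k / 2 \<le> real (m + i)" "0 \<le> b (m + i)" using nonneg[of "m + i"] by auto
    qed
    also have "\<dots> = (\<Sum>n=k-p+i..k+i. real n * b n)"
      by (rule sum.shift_bounds_cl_nat_ivl[symmetric])
    also have "\<dots> \<le> T"
      unfolding T_def using that k nonneg by (intro sum_mono2) (auto simp: p_def)
    finally show ?thesis .
  qed
  have "real k / 2 \<le> real (card {k-p..k})"
    using k by (simp add: p_def)
  then have "(real k / 2) * b k \<le> real (card {k-p..k}) * b k"
    using nonneg[OF k] by (rule mult_right_mono)
  also have "\<dots> = (\<Sum>m=k-p..k. b k)"
    by (rule sum_constant[symmetric])
  also have "\<dots> \<le> (\<Sum>m=k-p..k. (1 + M) * (\<Sum>i<N0. b (m + i)))"
    using k by (intro sum_mono term_le_window_sum) (auto simp: p_def)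
  also have "\<dots> = (1 + M) * (\<Sum>i<N0. \<Sum>m=k-p..k. b (m + i))"
    by (subst sum.swap) (simp add: sum_distrib_left)
  finally have "(real k / 2) * ((real k / 2) * b k) \<le> (real k / 2) * ((1 + M) * (\<Sum>i<N0. \<Sum>m=k-p..k. b (m + i)))"
    by (intro mult_left_mono) auto
  also have "\<dots> = (1 + M) * (\<Sum>i<N0. (real k / 2) * (\<Sum>m=k-p..k. b (m + i)))"
    by (simp only: mult.left_commute[of "real k / 2"]) (simp only: sum_distrib_left)
  also have "\<dots> \<le> (1 + M) * (\<Sum>i<N0. T)"
    using M_pos shifted by (intro mult_left_mono sum_mono) auto
  finally have "real k * (real k * b k) \<le> 4 * (1 + M) * real N0 * T"
    by (simp add: mult_ac)
  then have "real k * b k \<le> 4 * (1 + M) * real N0 * (T / real k)"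
    using k by (simp add: pos_le_divide_eq mult_ac)
  \<comment> \<open>The sum \<open>T\<close> has \<open>k + N0\<close> terms, so the denominator is
    adjusted to make it a shifted mean.\<close>
  also have "T / real k \<le> (1 + real N0) * (T / real (k + N0))"
  proof -
    have "real (k + N0) \<le> (1 + real N0) * real k"
      using k mult_left_mono[of 1 "real k" "real N0"] by (simp add: algebra_simps)
    then have "real (k + N0) * T \<le> (1 + real N0) * real k * T"
      using T by (rule mult_right_mono)
    then show ?thesis using k by (simp add: field_simps)
  qed
  finally show ?thesis
    using M_pos by (simp add: T_def mult_left_mono mult.assoc)
qed

lemma tendsto_0_if_continuous:
  assumes conv: "\<And>x. summable (\<lambda>n. b n * sin (real n * x))"
    and cont: "continuous_on UNIV (\<lambda>x. \<Sum>n. b n * sin (real n * x))"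
  shows "(\<lambda>n. real n * b n) \<longlonglongrightarrow> 0"
proof -
  interpret everywhere_convergent_sine_series b
    by unfold_locales (rule conv)
  have "(\<lambda>k. (\<Sum>n=1..k. real n * b n) / real k) \<longlonglongrightarrow> 0"
    using nonneg cont by (intro mean_tendsto_0_if_continuous) (auto simp: f_def[abs_def])
  then have "(\<lambda>k. (\<Sum>n=1..k+N0. real n * b n) / real (k + N0)) \<longlonglongrightarrow> 0"
    by (rule LIMSEQ_ignore_initial_segment)
  then have "(\<lambda>k. 4 * (1 + M) * real N0 * (1 + real N0) *
      ((\<Sum>n=1..k+N0. real n * b n) / real (k + N0))) \<longlonglongrightarrow> 0"
    by (rule tendsto_mult_right_zero)
  then show ?thesis
  proof (rule Lim_null_comparison[rotated])
    show "\<forall>\<^sub>F k in sequentially. norm (real k * b k) \<le> 4 * (1 + M) * real N0 * (1 + real N0) *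
      ((\<Sum>n=1..k+N0. real n * b n) / real (k + N0))"
      using eventually_ge_at_top[of 1]
      by eventually_elim (use of_nat_mult_le_mean nonneg in \<open>simp add: abs_mult\<close>)
  qed
qed

end

section \<open>Uniform convergence gives a continuous sum; the equivalences\<close>

lemma continuous_sum_if_uniformly_convergent:
  fixes b :: "nat \<Rightarrow> real"
  assumes "uniformly_convergent_on UNIV (\<lambda>N x. \<Sum>n=1..N. b n * sin (real n * x))"
  shows "summable (\<lambda>n. b n * sin (real n * x))"
    and "continuous_on UNIV (\<lambda>x. \<Sum>n. b n * sin (real n * x))"
proof -
  obtain l where l: "uniform_limit UNIV (\<lambda>N x. \<Sum>n=1..N. b n * sin (real n * x)) l sequentially"
    using assms unfolding uniformly_convergent_on_def by blast
  have sums: "(\<lambda>n. b n * sin (real n * x)) sums l x" for x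
    using tendsto_uniform_limitI[OF l, of x]
      LIMSEQ_sum_from_1_iff_sums[of "\<lambda>n. b n * sin (real n * x)"] by simp
  then show "summable (\<lambda>n. b n * sin (real n * x))" by (rule sums_summable)
  have "continuous_on UNIV l"
    by (rule uniform_limit_theorem[OF _ l]) (auto intro!: always_eventually continuous_intros)
  then show "continuous_on UNIV (\<lambda>x. \<Sum>n. b n * sin (real n * x))"
    using sums_unique[OF sums] by simp
qed

theorem theorem2:
  fixes b :: "nat \<Rightarrow> real"
  assumes nonneg: "\<And>n. n \<ge> 1 \<Longrightarrow> b n \<ge> 0"
    and cond: "\<exists>N0::nat. N0 \<ge> 1 \<and> (\<exists>M::real. M > 0 \<and>
          (\<forall>m::nat. m \<ge> 1 \<longrightarrow>
             (\<Sum>n=m..2*m. \<bar>b n - b (n+1)\<bar>) \<le> M * Max (b ` {m..<m+N0})))"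
  shows "(uniformly_convergent_on UNIV (\<lambda>N x. \<Sum>n\<in>{1..N}. b n * sin (real n * x))
            \<longleftrightarrow> (\<lambda>n. real n * b n) \<longlonglongrightarrow> 0)
       \<and> (((\<forall>x. summable (\<lambda>n. b n * sin (real n * x))) \<and>
             continuous_on UNIV (\<lambda>x. \<Sum>n. b n * sin (real n * x)))
            \<longleftrightarrow> (\<lambda>n. real n * b n) \<longlonglongrightarrow> 0)"
proof -
  obtain N0 M where "dyadic_bounded_variation b N0 M"
    using nonneg cond unfolding dyadic_bounded_variation_def by blast
  then interpret dyadic_bounded_variation b N0 M .
  \<comment> \<open>The implications form a cycle: decay gives (i), (i) gives (ii), and (ii) gives
    decay.\<close>
  show ?thesis
    using uniformly_convergent_if_tendsto_0 tendsto_0_if_continuous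
      continuous_sum_if_uniformly_convergent[of b] by (intro conjI iffI) auto
qed

end
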